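(* Let $k \ge 5$ and $n$ be integers such that $k$ divides $n$, $2$ divides $n$, and $n \ge 6k^2$. Then there is no planar graph on $n$ vertices that contains each of $C_{n,1}$, $C_{n,2}$ and $C_{n,k}$ as a subgraph.
   Context: A caterpillar is a tree in which the subgraph induced by the vertices of degree at least two is a path, called the spine. For positive integers $n,k$ with $k \mid n$, the $k$-caterpillar on $n$ vertices $C_{n,k}$ is the caterpillar whose spine is a path on $k$ vertices and in which every spine vertex is adjacent to exactly $\frac{n}{k}-1$ leaves; thus $C_{n,k}$ has $n$ vertices. In particular $C_{n,1}$ is the star $K_{1,n-1}$ and $C_{n,2}$ is a double star. Contained as a subgraph means there is an injective map of vertices sending edges to edges. *)

theory Defs
  imports "HOL-Analysis.Analysis" "Graph_Theory.Pair_Digraph"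
begin

text \<open>
  Finite simple graphs are \<^locale>\<open>pair_graph\<close>s: an undirected edge \<open>uv\<close> is the pair of arcs
  \<open>(u, v)\<close>, \<open>(v, u)\<close>.
\<close>

text \<open>
  The two arcs of an undirected edge are drawn as the same curve, traversed in opposite directions.
\<close>

definition plane_drawing ::
  "'a pair_pre_digraph \<Rightarrow> ('a \<Rightarrow> complex) \<Rightarrow> ('a \<times> 'a \<Rightarrow> real \<Rightarrow> complex) \<Rightarrow> bool"
where
  "plane_drawing G \<phi> \<gamma> \<longleftrightarrow>
     inj_on \<phi> (pverts G) \<and>
     (\<forall>u v. (u, v) \<in> parcs G \<longrightarrow>
        arc (\<gamma> (u, v)) \<and> pathstart (\<gamma> (u, v)) = \<phi> u \<and> pathfinish (\<gamma> (u, v)) = \<phi> v \<and>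
        \<gamma> (v, u) = reversepath (\<gamma> (u, v)) \<and>
        path_image (\<gamma> (u, v)) \<inter> \<phi> ` pverts G = {\<phi> u, \<phi> v}) \<and>
     (\<forall>e \<in> parcs G. \<forall>f \<in> parcs G. f \<noteq> e \<and> f \<noteq> prod.swap e \<longrightarrow>
        path_image (\<gamma> e) \<inter> path_image (\<gamma> f) \<subseteq> \<phi> ` pverts G)"

definition planar :: "'a pair_pre_digraph \<Rightarrow> bool" where
  "planar G \<longleftrightarrow> (\<exists>\<phi> \<gamma>. plane_drawing G \<phi> \<gamma>)"

definition contains_subgraph :: "'a pair_pre_digraph \<Rightarrow> 'b pair_pre_digraph \<Rightarrow> bool" where
  "contains_subgraph G H \<longleftrightarrow>
     (\<exists>f. inj_on f (pverts H) \<and> f ` pverts H \<subseteq> pverts G \<and>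
          (\<forall>u v. (u, v) \<in> parcs H \<longrightarrow> (f u, f v) \<in> parcs G))"

text \<open>
  The \<open>k\<close>-caterpillar on \<open>n\<close> vertices, for \<open>k\<close> dividing \<open>n\<close>: the spine is \<open>(0,0), \<dots>, (k-1,0)\<close>, and the
  leaves at \<open>(i,0)\<close> are the vertices \<open>(i,j)\<close> with \<open>0 < j < n/k\<close>.
\<close>

definition caterpillar_arcs :: "nat \<Rightarrow> nat \<Rightarrow> (nat \<times> nat) rel" where
  "caterpillar_arcs n k =
     {((i, 0), (Suc i, 0)) | i. Suc i < k} \<union>
     {((i, 0), (i, j)) | i j. i < k \<and> 0 < j \<and> j < n div k}"

definition caterpillar :: "nat \<Rightarrow> nat \<Rightarrow> (nat \<times> nat) pair_pre_digraph" where
  "caterpillar n k =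
     \<lparr> pverts = {..<k} \<times> {..<n div k},
       parcs = caterpillar_arcs n k \<union> (caterpillar_arcs n k)\<inverse> \<rparr>"

lemma card_caterpillar:
  assumes "k dvd n"
  shows "card (pverts (caterpillar n k)) = n"
  using assms by (simp add: caterpillar_def card_cartesian_product)

lemma pair_graph_caterpillar:
  assumes "0 < n" and "k dvd n"
  shows "pair_graph (caterpillar n k)"
proof -
  let ?C = "caterpillar n k"
  have "0 < n div k"
    using assms by (auto simp: dvd_def)
  then have sub: "parcs ?C \<subseteq> pverts ?C \<times> pverts ?C"
    by (auto simp: caterpillar_def caterpillar_arcs_def)
  have fin: "finite (pverts ?C)"
    by (simp add: caterpillar_def)
  show ?thesis
  proof
    show "finite (parcs ?C)"
      using sub fin by (meson finite_SigmaI finite_subset)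
    show "symmetric (with_proj ?C)"
      by (auto simp: symmetric_def caterpillar_def sym_def)
    show "fst e \<noteq> snd e" if "e \<in> parcs ?C" for e
      using that by (auto simp: caterpillar_def caterpillar_arcs_def)
  qed (use sub fin in auto)
qed

end

theory Submission
  imports Defs
begin

text \<open>
  The only consequence of planarity that is needed is that \<open>K\<^bsub>3,3\<^esub>\<close> is not planar, so that three
  distinct vertices have at most two common neighbours. The star provides a vertex \<open>u\<close> adjacent to
  all others. Let \<open>a\<close>, \<open>b\<close> be the centres of the double star. A spine vertex \<open>v\<close> outside
  \<open>{u, a, b}\<close> has at most two common neighbours with each of \<open>a\<close> and \<open>b\<close>, apart from \<open>u\<close>. If \<open>u\<close> is neither
  \<open>a\<close> nor \<open>b\<close>, then nearly all vertices are adjacent to \<open>a\<close> or \<open>b\<close>, and \<open>v\<close> has too few neighbours.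
  If \<open>u = a\<close>, then nearly all leaves of at least \<open>k - 2\<close> spine vertices lie among the \<open>n/2 - 1\<close>
  vertices that are leaves at \<open>a\<close>, which is too little room.

  In a drawing of \<open>K\<^bsub>3,3\<^esub>\<close>, two vertices of one class span a theta graph whose three arcs pass
  through the vertices of the other class, and the remaining vertex lies in a face touching all
  three arcs. Such a face contradicts the Jordan curve theorem together with Janiszewski's theorem.
\<close>

section \<open>Theta graphs and \<open>K\<^bsub>3,3\<^esub>\<close>\<close>

text \<open>Adjoining to \<open>A\<close> a point of its closure keeps it connected, and a point
  taken from \<open>B\<close> makes the two sets overlap.\<close>

lemma connected_Un_closure:
  assumes "connected A" "connected B" "closure A \<inter> B \<noteq> {}"
  shows "connected (A \<union> B)"
proof -
  obtain y where y: "y \<in> closure A" "y \<in> B"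
    using assms(3) by auto
  have "connected (insert y A)"
    using connected_intermediate_closure[OF assms(1), of "insert y A"] y closure_subset by auto
  then have "connected (insert y A \<union> B)"
    using assms(2) y by (intro connected_Un) auto
  then show ?thesis
    using y by (simp add: insert_absorb)
qed

text \<open>Meant for two regions \<open>A\<close> and \<open>B\<close> that touch the same open arc
  \<open>Q\<close>, which then bridges them.\<close>

lemma connected_component_closure_bridge:
  assumes "connected A" "connected B" "connected Q"
    and "closure A \<inter> Q \<noteq> {}" "closure B \<inter> Q \<noteq> {}"
    and "A \<union> B \<union> Q \<subseteq> S" "x \<in> A" "y \<in> B"
  shows "connected_component S x y"
proof -
  have "connected (A \<union> Q)" "connected (B \<union> Q)"
    using assms by (simp_all add: connected_Un_closure)
  then have "connected ((A \<union> Q) \<union> (B \<union> Q))"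
    by (rule connected_Un) (use assms(4) in blast)
  then show ?thesis
    unfolding connected_component_def using assms(6-8) by blast
qed

text \<open>If \<open>W\<close> touched all three arcs, it could be joined to the side
  \<open>D\<close> of \<open>p1 \<union> p2\<close> away from \<open>p3\<close>, first avoiding
  \<open>p1 \<union> p3\<close> and then avoiding \<open>p2 \<union> p3\<close>. Janiszewski's
  theorem would join them off all three arcs, although \<open>W\<close> touches \<open>p3\<close>
  and so lies on the other side.\<close>

lemma theta_no_common_face:
  fixes p1 p2 p3 :: "real \<Rightarrow> complex"
  assumes "arc p1" "arc p2" "arc p3"
    and "pathstart p1 = a" "pathstart p2 = a" "pathstart p3 = a"
    and "pathfinish p1 = b" "pathfinish p2 = b" "pathfinish p3 = b"
    and "path_image p1 \<inter> path_image p2 = {a, b}"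
    and "path_image p1 \<inter> path_image p3 = {a, b}"
    and "path_image p2 \<inter> path_image p3 = {a, b}"
    and "connected W"
    and "W \<inter> path_image p1 = {}" "W \<inter> path_image p2 = {}" "W \<inter> path_image p3 = {}"
  shows "closure W \<inter> (path_image p1 - {a, b}) = {} \<or>
         closure W \<inter> (path_image p2 - {a, b}) = {} \<or>
         closure W \<inter> (path_image p3 - {a, b}) = {}"
proof (rule ccontr)
  let ?P1 = "path_image p1" and ?P2 = "path_image p2" and ?P3 = "path_image p3"
  define Q1 Q2 Q3 where "Q1 = ?P1 - {a, b}" and "Q2 = ?P2 - {a, b}" and "Q3 = ?P3 - {a, b}"
  note Q_defs = Q1_def Q2_def Q3_def
  assume "\<not> ?thesis"
  then have W1: "closure W \<inter> Q1 \<noteq> {}" and W2: "closure W \<inter> Q2 \<noteq> {}"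
    and W3: "closure W \<inter> Q3 \<noteq> {}"
    unfolding Q_defs by auto
  have cQ1: "connected Q1"
    using connected_simple_path_endless[OF arc_imp_simple_path[OF assms(1)]] assms
    by (simp add: Q_defs)
  have cQ2: "connected Q2"
    using connected_simple_path_endless[OF arc_imp_simple_path[OF assms(2)]] assms
    by (simp add: Q_defs)
  have cQ3: "connected Q3"
    using connected_simple_path_endless[OF arc_imp_simple_path[OF assms(3)]] assms
    by (simp add: Q_defs)
  define c where "c = p1 +++ reversepath p2"
  have c: "simple_path c" "pathfinish c = pathstart c"
    unfolding c_def using assms by (auto intro!: simple_path_join_loop simp: arc_reversepath)
  have imc: "path_image c = ?P1 \<union> ?P2"
    unfolding c_def using assms by (simp add: path_image_join)
  note J = Jordan_inside_outside[OF c, unfolded imc]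
  let ?C = "?P1 \<union> ?P2"
  have side: "S \<subseteq> inside ?C \<or> S \<subseteq> outside ?C" if "connected S" "S \<inter> ?C = {}" for S
  proof -
    have "S \<subseteq> inside ?C \<union> outside ?C"
      using that J by blast
    moreover have "open (inside ?C)" "open (outside ?C)" "inside ?C \<inter> outside ?C = {}"
      using J by simp_all
    ultimately show ?thesis
      using connectedD[OF that(1), of "inside ?C" "outside ?C"] by blast
  qed
  have "Q3 \<inter> ?C = {}"
    unfolding Q_defs using assms by blast
  \<comment> \<open>Naming the sides by the position of \<open>Q3\<close> treats inside and outside
    alike: \<open>D\<close> is the side without \<open>Q3\<close>, and its frontier is the whole
    curve.\<close>
  from side[OF cQ3 this] obtain D E
    where D: "D \<noteq> {}" "connected D" "open D" "frontier D = ?C"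
      and E: "open E" "D \<inter> E = {}" "D \<union> E = - ?C" "Q3 \<subseteq> E"
  proof
    assume "Q3 \<subseteq> inside ?C"
    then show thesis
      using J by (intro that[of "outside ?C" "inside ?C"]) (simp_all add: Int_commute Un_commute)
  next
    assume "Q3 \<subseteq> outside ?C"
    then show thesis
      using J by (intro that[of "inside ?C" "outside ?C"]) simp_all
  qed
  obtain p where p: "p \<in> D"
    using D by auto
  obtain w where w: "w \<in> W"
    using W1 by fastforce
  have QP: "Q1 \<subseteq> ?P1" "Q2 \<subseteq> ?P2"
    by (auto simp: Q_defs)
  have clD: "?C \<subseteq> closure D"
    using D by (auto simp: frontier_def)
  have D3: "D \<inter> ?P3 = {}"
  proof -
    have "a \<in> ?C" "b \<in> ?C"
      using assms by blast+
    then show ?thesis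
      using E unfolding Q_defs by blast
  qed
  have DC: "D \<inter> ?P1 = {}" "D \<inter> ?P2 = {}"
    using E(3) by blast+
  have "Q1 \<inter> ?P2 = {}" "Q1 \<inter> ?P3 = {}" "Q2 \<inter> ?P3 = {}"
    "Q2 \<inter> ?P1 = {}" "Q3 \<inter> ?P1 = {}" "Q3 \<inter> ?P2 = {}"
    unfolding Q_defs using assms(10-12) by blast+
  note dis = this DC D3 assms(14-16)
  \<comment> \<open>\<open>D\<close> and \<open>W\<close> both touch \<open>p2\<close>, so the curve \<open>p1 \<union> p3\<close> does not separate them; likewise \<open>p2 \<union> p3\<close>.\<close>
  have "(D \<union> W \<union> Q2) \<inter> (?P1 \<union> ?P3) = {}"
    by (simp add: Int_Un_distrib Int_Un_distrib2 dis)
  moreover have "closure D \<inter> Q2 \<noteq> {}"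
    using W2 clD QP by blast
  ultimately have pw2: "connected_component (- (?P1 \<union> ?P3)) p w"
    using connected_component_closure_bridge[OF D(2) assms(13) cQ2 _ W2 _ p w]
    by (simp add: disjoint_eq_subset_Compl)
  have "(D \<union> W \<union> Q1) \<inter> (?P2 \<union> ?P3) = {}"
    by (simp add: Int_Un_distrib Int_Un_distrib2 dis)
  moreover have "closure D \<inter> Q1 \<noteq> {}"
    using W1 clD QP by blast
  ultimately have pw1: "connected_component (- (?P2 \<union> ?P3)) p w"
    using connected_component_closure_bridge[OF D(2) assms(13) cQ1 _ W1 _ p w]
    by (simp add: disjoint_eq_subset_Compl)
  \<comment> \<open>The two closed curves meet exactly in \<open>p3\<close>; Janiszewski's theorem
    asks for this intersection to be connected.\<close>
  have "(?P1 \<union> ?P3) \<inter> (?P2 \<union> ?P3) = ?P3"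
  proof -
    have "{a, b} \<subseteq> ?P3"
      using assms(11) by blast
    then show ?thesis
      using assms(10) by blast
  qed
  moreover have "connected ?P3" "compact (?P1 \<union> ?P3)" "closed (?P2 \<union> ?P3)"
    using assms(1-3) by (auto simp: arc_imp_path connected_path_image compact_path_image
        compact_Un compact_imp_closed closed_Un)
  ultimately have "connected_component (- ((?P1 \<union> ?P3) \<union> (?P2 \<union> ?P3))) p w"
    using Janiszewski[OF _ _ _ pw2 pw1] by simp
  then obtain T where T: "connected T" "T \<subseteq> - ?C" "p \<in> T" "w \<in> T"
    by (auto simp: connected_component_def)
  \<comment> \<open>\<open>W\<close> touches \<open>Q3\<close> and avoids \<open>p1\<close> and
    \<open>p2\<close>, so it lies in \<open>E\<close>. This clashes with \<open>T\<close>, which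
    links \<open>p\<close> in \<open>D\<close> to \<open>w\<close> without meeting the
    curve.\<close>
  have "connected (W \<union> Q3)"
    by (rule connected_Un_closure[OF assms(13) cQ3 W3])
  moreover have "W \<union> Q3 \<subseteq> D \<union> E"
    unfolding E(3) disjoint_eq_subset_Compl[symmetric]
    by (simp add: Int_Un_distrib Int_Un_distrib2 dis)
  moreover have "Q3 \<inter> E \<noteq> {}"
    using E W3 by blast
  ultimately have "w \<in> E"
    using connectedD[of "W \<union> Q3" D E] D(3) E(1,2) w by blast
  then show False
    using connectedD[OF T(1) D(3) E(1)] E T p by blast
qed

text \<open>Only the reverse arc shares the curve; the curve of any other arc can be met only at
  vertices, and a curve passes through no vertices but its own ends.\<close>

lemma plane_drawing_images_Int:
  assumes "plane_drawing G \<phi> \<gamma>" "(u, v) \<in> parcs G" "(u', v') \<in> parcs G"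
    and "(u', v') \<noteq> (u, v)" "(u', v') \<noteq> (v, u)"
  shows "path_image (\<gamma> (u, v)) \<inter> path_image (\<gamma> (u', v')) \<subseteq> {\<phi> u, \<phi> v} \<inter> {\<phi> u', \<phi> v'}"
proof -
  have "path_image (\<gamma> (u, v)) \<inter> path_image (\<gamma> (u', v')) \<subseteq> \<phi> ` pverts G"
    using assms unfolding plane_drawing_def by (metis swap_simp)
  moreover have "path_image (\<gamma> (u, v)) \<inter> \<phi> ` pverts G = {\<phi> u, \<phi> v}"
    "path_image (\<gamma> (u', v')) \<inter> \<phi> ` pverts G = {\<phi> u', \<phi> v'}"
    using assms unfolding plane_drawing_def by blast+
  ultimately show ?thesis
    by blast
qed

lemma pathfinish_in_closure:
  fixes p :: "real \<Rightarrow> 'a::real_normed_vector"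
  assumes "path p"
  shows "pathfinish p \<in> closure (p ` {0..<1})"
proof -
  have "p ` closure {0..<1} \<subseteq> closure (p ` {0..<1})"
    using assms by (intro continuous_image_closure_subset[of "{0..1}"]) (auto simp: path_def)
  then show ?thesis
    by (auto simp: pathfinish_def)
qed

lemma (in pair_graph) K33_not_planar:
  assumes "planar G"
    and x: "distinct [x1, x2, x3]" and y: "distinct [y1, y2, y3]"
    and arcs: "{x1, x2, x3} \<times> {y1, y2, y3} \<subseteq> parcs G"
  shows False
proof -
  obtain \<phi> \<gamma> where dr: "plane_drawing G \<phi> \<gamma>"
    using assms(1) by (auto simp: planar_def)
  let ?X = "{x1, x2, x3}" and ?Y = "{y1, y2, y3}"
  have symG: "(t, s) \<in> parcs G" if "(s, t) \<in> parcs G" for s t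
    using that pair_sym_arcs by (auto simp: symmetric_def sym_def)
  have V: "?X \<subseteq> pverts G" "?Y \<subseteq> pverts G"
    using arcs by (auto dest: arc_fst_in_verts arc_snd_in_verts)
  have neq: "s \<noteq> t" if "s \<in> ?X" "t \<in> ?Y" for s t
    using arcs that pair_no_loops[of "(s, t)"] by auto
  have inj: "\<phi> s = \<phi> t \<longleftrightarrow> s = t" if "s \<in> ?X \<union> ?Y" "t \<in> ?X \<union> ?Y" for s t
  proof -
    have "s \<in> pverts G" "t \<in> pverts G"
      using that V by blast+
    then show ?thesis
      using dr by (auto simp: plane_drawing_def inj_on_def)
  qed
  have g: "Path_Connected.arc (\<gamma> (s, t))" "pathstart (\<gamma> (s, t)) = \<phi> s" "pathfinish (\<gamma> (s, t)) = \<phi> t"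
      "path_image (\<gamma> (t, s)) = path_image (\<gamma> (s, t))"
    if "(s, t) \<in> parcs G" for s t
    using dr that unfolding plane_drawing_def by auto
  have meet: "path_image (\<gamma> (s, t)) \<inter> path_image (\<gamma> (s', t')) \<subseteq> {\<phi> s, \<phi> t} \<inter> {\<phi> s', \<phi> t'}"
    if "s \<in> ?X" "s' \<in> ?X" "t \<in> ?Y" "t' \<in> ?Y" "(s, t) \<noteq> (s', t')" for s s' t t'
  proof (rule plane_drawing_images_Int[OF dr])
    show "(s, t) \<in> parcs G" "(s', t') \<in> parcs G"
      using arcs that by blast+
    show "(s', t') \<noteq> (s, t)" "(s', t') \<noteq> (t, s)"
      using that neq[of s' t'] neq[of s t'] by auto
  qed
  \<comment> \<open>The theta graph consists of the three paths from \<open>x1\<close> to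
    \<open>x2\<close>, one through each \<open>t\<close> in \<open>?Y\<close>.\<close>
  define P where "P t = \<gamma> (x1, t) +++ \<gamma> (t, x2)" for t
  have A: "(x1, t) \<in> parcs G" "(x2, t) \<in> parcs G" "(x3, t) \<in> parcs G" "(t, x2) \<in> parcs G"
    if "t \<in> ?Y" for t
    using arcs that symG by blast+
  have imP: "path_image (P t) = path_image (\<gamma> (x1, t)) \<union> path_image (\<gamma> (x2, t))" if "t \<in> ?Y" for t
    unfolding P_def using g A[OF that] by (simp add: path_image_join)
  have Pst: "pathstart (P t) = \<phi> x1" "pathfinish (P t) = \<phi> x2" if "t \<in> ?Y" for t
    unfolding P_def using g A[OF that] by simp_all
  have Parc: "Path_Connected.arc (P t)" if t: "t \<in> ?Y" for t
    unfolding P_def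
  proof (rule arc_join)
    have "path_image (\<gamma> (x1, t)) \<inter> path_image (\<gamma> (x2, t)) \<subseteq> {\<phi> x1, \<phi> t} \<inter> {\<phi> x2, \<phi> t}"
      using t x by (intro meet) auto
    also have "\<dots> \<subseteq> {\<phi> t}"
      using x inj[of x1 x2] by auto
    finally show "path_image (\<gamma> (x1, t)) \<inter> path_image (\<gamma> (t, x2)) \<subseteq> {pathstart (\<gamma> (t, x2))}"
      using g A[OF t] by simp
  qed (use g A[OF t] in simp_all)
  have PP: "path_image (P s) \<inter> path_image (P t) = {\<phi> x1, \<phi> x2}"
    if st: "s \<in> ?Y" "t \<in> ?Y" "s \<noteq> t" for s t
  proof
    show "path_image (P s) \<inter> path_image (P t) \<subseteq> {\<phi> x1, \<phi> x2}"
      unfolding imP[OF st(1)] imP[OF st(2)]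
      using meet[of x1 x1 s t] meet[of x1 x2 s t] meet[of x2 x1 s t] meet[of x2 x2 s t]
        st inj[of s t] by fastforce
    show "{\<phi> x1, \<phi> x2} \<subseteq> path_image (P s) \<inter> path_image (P t)"
      using Pst[OF st(1)] Pst[OF st(2)] by (metis IntI empty_subsetI insert_subset
          pathfinish_in_path_image pathstart_in_path_image)
  qed
  \<comment> \<open>The end \<open>\<phi> t\<close> is cut off, so that the star \<open>W\<close> at
    \<open>x3\<close> built from these pieces avoids the theta graph but keeps each
    \<open>\<phi> t\<close> in its closure.\<close>
  define R where "R t = \<gamma> (x3, t) ` {0..<1}" for t
  have Rim: "R t \<subseteq> path_image (\<gamma> (x3, t)) - {\<phi> t}" if t: "t \<in> ?Y" for t
  proof -
    have "inj_on (\<gamma> (x3, t)) {0..1}" "\<gamma> (x3, t) 1 = \<phi> t"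
      using g A[OF t] by (auto simp: Path_Connected.arc_def pathfinish_def)
    then have "\<gamma> (x3, t) s \<noteq> \<phi> t" if "s \<in> {0..<1}" for s
      using that inj_onD[of "\<gamma> (x3, t)" "{0..1}" s 1] by auto
    then show ?thesis
      by (auto simp: R_def path_image_def)
  qed
  have Rx3: "\<phi> x3 \<in> R t" if t: "t \<in> ?Y" for t
    using g(2)[OF A(3)[OF t]] by (force simp: R_def pathstart_def)
  have Rcon: "connected (R t)" if t: "t \<in> ?Y" for t
    unfolding R_def using g(1)[OF A(3)[OF t]]
    by (intro connected_continuous_image)
       (auto simp: Path_Connected.arc_def path_def elim: continuous_on_subset)
  have Rcl: "\<phi> t \<in> closure (R t)" if t: "t \<in> ?Y" for t
    using pathfinish_in_closure[of "\<gamma> (x3, t)"] g A[OF t] by (simp add: R_def arc_imp_path)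
  have RP: "R s \<inter> path_image (P t) = {}" if st: "s \<in> ?Y" "t \<in> ?Y" for s t
  proof -
    have "path_image (\<gamma> (x3, s)) \<inter> path_image (P t) \<subseteq> {\<phi> s}"
      unfolding imP[OF st(2)]
      using meet[of x3 x1 s t] meet[of x3 x2 s t] st x inj[of x3 x1] inj[of x3 x2] inj[of x3 t]
        neq[of x3 t] by fastforce
    then show ?thesis
      using Rim[OF st(1)] by blast
  qed
  define W where "W = (\<Union>t\<in>?Y. R t)"
  have Wcon: "connected W"
    unfolding W_def
  proof (rule connected_Union)
    have "\<phi> x3 \<in> \<Inter> (R ` ?Y)"
      using Rx3 by blast
    then show "\<Inter> (R ` ?Y) \<noteq> {}"
      by blast
  qed (use Rcon in blast)
  have WP: "W \<inter> path_image (P t) = {}" if "t \<in> ?Y" for t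
    using RP that by (auto simp: W_def)
  have Wcl: "closure W \<inter> (path_image (P t) - {\<phi> x1, \<phi> x2}) \<noteq> {}" if t: "t \<in> ?Y" for t
  proof -
    have "\<phi> t \<in> closure W"
      using Rcl[OF t] closure_mono[of "R t" W] t by (auto simp: W_def)
    moreover have "\<phi> t \<in> path_image (P t)"
      using g A[OF t] imP[OF t] by (metis UnI1 pathfinish_in_path_image)
    moreover have "\<phi> t \<notin> {\<phi> x1, \<phi> x2}"
      using t neq[of x1 t] neq[of x2 t] inj[of t x1] inj[of t x2] by auto
    ultimately show ?thesis
      by blast
  qed
  show False
    using theta_no_common_face[of "P y1" "P y2" "P y3" "\<phi> x1" "\<phi> x2" W]
      Parc Pst PP WP Wcon Wcl y by simp
qed

section \<open>Common neighbours in planar graphs\<close>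

lemma (in pair_graph) finite_neighbours: "finite (parcs G `` {x})"
  using pair_finite_arcs by (rule finite_Image)

lemma (in pair_graph) card_common_neighbours_le_2:
  assumes "planar G" "distinct [x1, x2, x3]"
  shows "card (parcs G `` {x1} \<inter> parcs G `` {x2} \<inter> parcs G `` {x3}) \<le> 2"
    (is "card ?N \<le> 2")
proof (rule ccontr)
  assume "\<not> card ?N \<le> 2"
  then obtain Y where "Y \<subseteq> ?N" "card Y = 3"
    by (metis not_less_eq_eq numeral_2_eq_2 numeral_3_eq_3 obtain_subset_with_card_n)
  then obtain y1 y2 y3 where "{y1, y2, y3} \<subseteq> ?N" "distinct [y1, y2, y3]"
    by (auto simp: card_3_iff)
  then show False
    using K33_not_planar[OF assms, of y1 y2 y3] by auto
qed

section \<open>Counting leaves\<close>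

text \<open>Host and caterpillar both have \<open>n\<close> vertices, so the embedding is onto:
  spine images \<open>c i\<close> and leaf sets \<open>L i\<close> exhaust \<open>G\<close>.\<close>

lemma contains_caterpillarE:
  assumes "contains_subgraph G (caterpillar n k)" "k dvd n" "0 < n"
    and "finite (pverts G)" "card (pverts G) = n"
  obtains c L where "inj_on c {..<k}"
    and "\<And>i. i < k \<Longrightarrow> L i \<subseteq> parcs G `` {c i}"
    and "\<And>i. i < k \<Longrightarrow> card (L i) = n div k - 1"
    and "disjoint_family_on L {..<k}"
    and "pverts G = c ` {..<k} \<union> (\<Union>i<k. L i)"
proof -
  let ?m = "n div k"
  obtain f where inj: "inj_on f ({..<k} \<times> {..<?m})"
    and sub: "f ` ({..<k} \<times> {..<?m}) \<subseteq> pverts G"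
    and arcs: "\<And>u v. (u, v) \<in> caterpillar_arcs n k \<Longrightarrow> (f u, f v) \<in> parcs G"
    using assms(1) by (auto simp: contains_subgraph_def caterpillar_def)
  have m: "0 < ?m"
    using assms by (auto simp: dvd_def)
  have "card (f ` ({..<k} \<times> {..<?m})) = n"
    using inj assms(2) by (simp add: card_image card_cartesian_product)
  then have im: "f ` ({..<k} \<times> {..<?m}) = pverts G"
    using sub assms by (simp add: card_subset_eq)
  define c where "c i = f (i, 0)" for i
  define L where "L i = f ` ({i} \<times> {0<..<?m})" for i
  show thesis
  proof
    show "inj_on c {..<k}"
      using inj m by (auto simp: inj_on_def c_def)
    show "L i \<subseteq> parcs G `` {c i}" if "i < k" for i
      using that by (auto simp: L_def c_def caterpillar_arcs_def intro!: arcs)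
    show "card (L i) = n div k - 1" if "i < k" for i
    proof -
      have "inj_on f ({i} \<times> {0<..<?m})"
        using inj by (rule inj_on_subset) (use that in auto)
      then show ?thesis
        by (simp add: L_def card_image card_cartesian_product)
    qed
    show "disjoint_family_on L {..<k}"
      using inj by (fastforce simp: disjoint_family_on_def L_def inj_on_def)
    have "{..<k} \<times> {..<?m} = {..<k} \<times> {0} \<union> (\<Union>i<k. {i} \<times> {0<..<?m})"
      using m by auto
    then show "pverts G = c ` {..<k} \<union> (\<Union>i<k. L i)"
      unfolding im[symmetric] c_def L_def by (auto simp: image_Un image_UN)
  qed
qed

text \<open>Here \<open>u\<close> is both the universal vertex and a double star centre with leaf
  set \<open>A\<close>. Leaves of the long caterpillar that are not adjacent to \<open>b\<close> are
  crowded into \<open>A\<close>. Naming only the other centre \<open>b\<close> lets the lemma serve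
  both centres.\<close>

lemma (in pair_graph) universal_not_double_star_centre:
  fixes n k :: nat
  assumes "planar G" and "k \<ge> 5" and "k dvd n" and "n \<ge> 6 * k\<^sup>2"
    and univ: "pverts G - {u} \<subseteq> parcs G `` {u}"
    and c: "inj_on c {..<k}" "\<And>i. i < k \<Longrightarrow> L i \<subseteq> parcs G `` {c i}"
      "\<And>i. i < k \<Longrightarrow> card (L i) = n div k - 1" "disjoint_family_on L {..<k}"
    and "u \<noteq> b" and cover: "pverts G \<subseteq> {u, b} \<union> A \<union> B" and B: "B \<subseteq> parcs G `` {b}"
    and A: "finite A" "card A < n div 2"
  shows False
proof -
  define m where "m = n div k"
  have n: "n = k * m"
    using assms by (simp add: m_def)
  have m: "6 * k \<le> m"
    using assms(2,4) unfolding n by (simp add: power2_eq_square)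
  define I where "I = {i. i < k \<and> c i \<notin> {u, b}}"
  have finL: "finite (L i)" if "i < k" for i
    using c(2)[OF that] finite_neighbours by (rule finite_subset)
  have "card ({..<k} - I) \<le> card {u, b}"
    by (rule card_inj_on_le[of c]) (use c in \<open>auto simp: I_def inj_on_def\<close>)
  also have "\<dots> \<le> 2"
    by (simp add: card_insert_if)
  finally have I: "k - 2 \<le> card I"
    by (subst (asm) card_Diff_subset) (auto simp: I_def)
  define M where "M i = L i - {u, b} - parcs G `` {b}" for i
  have "m - 5 \<le> card (M i)" if "i \<in> I" for i
  proof -
    have i: "i < k" "c i \<noteq> u" "c i \<noteq> b"
      using that by (auto simp: I_def)
    let ?N = "parcs G `` {c i} \<inter> parcs G `` {b} \<inter> parcs G `` {u}"
    have N: "finite ?N" "card ?N \<le> 2"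
      using card_common_neighbours_le_2[OF assms(1), of "c i" b u] i \<open>u \<noteq> b\<close> finite_neighbours
      by auto
    \<comment> \<open>A leaf other than \<open>u\<close> is adjacent to \<open>u\<close>, so one
      adjacent to \<open>b\<close> as well falls into \<open>?N\<close>. At most 2 + 2 of the
      \<open>m - 1\<close> leaves are lost, whence \<open>m - 5\<close>.\<close>
    have "L i \<subseteq> M i \<union> ({u, b} \<union> ?N)"
      using c(2)[OF i(1)] univ arc_snd_in_verts unfolding M_def by force
    then have "card (L i) \<le> card (M i \<union> ({u, b} \<union> ?N))"
      using N finL[OF i(1)] by (intro card_mono) (auto simp: M_def)
    also have "\<dots> \<le> card (M i) + (card {u, b} + card ?N)"
      by (meson add_left_mono card_Un_le le_trans)
    also have "\<dots> \<le> card (M i) + 4"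
      using N \<open>u \<noteq> b\<close> by simp
    finally show ?thesis
      using c(3)[OF i(1)] by (simp add: m_def)
  qed
  then have "card I * (m - 5) \<le> (\<Sum>i\<in>I. card (M i))"
    using sum_bounded_below[of I "m - 5" "\<lambda>i. card (M i)"] by simp
  also have "\<dots> = card (\<Union>i\<in>I. M i)"
    by (rule card_UN_disjoint[symmetric])
       (use c(4) finL in \<open>auto simp: I_def M_def disjoint_family_on_def\<close>)
  also have "\<dots> \<le> card A"
  proof (rule card_mono[OF A(1)])
    have "L i \<subseteq> pverts G" if "i < k" for i
      using c(2)[OF that] arc_snd_in_verts by force
    then show "(\<Union>i\<in>I. M i) \<subseteq> A"
      using cover B by (fastforce simp: I_def M_def)
  qed
  finally have "(k - 2) * (m - 5) \<le> card A"
    using mult_le_mono1[OF I] by (metis le_trans)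
  then have le: "2 * ((k - 2) * (m - 5)) < k * m"
    using A(2) n by linarith
  \<comment> \<open>These substitutions remove the truncated subtractions. The left side of
    \<open>le\<close> exceeds the right by \<open>6*j^2 + 26*j + (j + 1)*l\<close>, which vanishes
    at \<open>j = l = 0\<close>, so the strictness of \<open>card A < n div 2\<close>
    matters.\<close>
  obtain j where j: "k = j + 5"
    using assms(2) by (metis add.commute le_Suc_ex)
  obtain l where l: "m = 6 * j + 30 + l"
    using le_Suc_ex[OF m] unfolding j by auto
  show False
    using le unfolding j l by (simp add: algebra_simps)
qed

section \<open>Combining the three caterpillars\<close>

theorem theorem8:
  fixes n k :: nat
  assumes "k \<ge> 5" and "k dvd n" and "2 dvd n" and "n \<ge> 6 * k\<^sup>2"
  shows "\<not> (\<exists>G :: 'a pair_pre_digraph.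
           pair_graph G \<and> card (pverts G) = n \<and> planar G \<and>
           contains_subgraph G (caterpillar n 1) \<and>
           contains_subgraph G (caterpillar n 2) \<and>
           contains_subgraph G (caterpillar n k))"
proof
  assume "\<exists>G :: 'a pair_pre_digraph.
           pair_graph G \<and> card (pverts G) = n \<and> planar G \<and>
           contains_subgraph G (caterpillar n 1) \<and>
           contains_subgraph G (caterpillar n 2) \<and>
           contains_subgraph G (caterpillar n k)"
  then obtain G :: "'a pair_pre_digraph" where G: "pair_graph G" "card (pverts G) = n" "planar G"
    and C1: "contains_subgraph G (caterpillar n 1)"
    and C2: "contains_subgraph G (caterpillar n 2)"
    and Ck: "contains_subgraph G (caterpillar n k)"
    by blast
  interpret pair_graph G
    by fact
  have k2: "5 * k \<le> k\<^sup>2"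
    using assms(1) by (simp add: power2_eq_square)
  have n: "0 < n"
    using assms(1,4) k2 by linarith
  obtain u where univ: "pverts G - {u} \<subseteq> parcs G `` {u}"
  proof (rule contains_caterpillarE[OF C1 _ n pair_finite_verts G(2)])
    fix c :: "nat \<Rightarrow> 'a" and L
    assume "\<And>i. i < 1 \<Longrightarrow> L i \<subseteq> parcs G `` {c i}"
      and "pverts G = c ` {..<1} \<union> (\<Union>i<1. L i)"
    then have "pverts G - {c (0 :: nat)} \<subseteq> parcs G `` {c 0}"
      by (auto simp: lessThan_Suc)
    then show thesis
      by (rule that)
  qed simp
  obtain a b A B where ab: "a \<noteq> b" "A \<subseteq> parcs G `` {a}" "B \<subseteq> parcs G `` {b}"
    and cAB: "card A = n div 2 - 1" "card B = n div 2 - 1"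
    and cover: "pverts G = {a, b} \<union> A \<union> B"
  proof (rule contains_caterpillarE[OF C2 assms(3) n pair_finite_verts G(2)])
    fix c :: "nat \<Rightarrow> 'a" and L
    assume inj: "inj_on c {..<2}" and L: "\<And>i. i < 2 \<Longrightarrow> L i \<subseteq> parcs G `` {c i}"
      and card: "\<And>i. i < 2 \<Longrightarrow> card (L i) = n div 2 - 1"
      and cov: "pverts G = c ` {..<2} \<union> (\<Union>i<2. L i)"
    have two: "{..<2} = {0, 1 :: nat}"
      by auto
    show thesis
      by (rule that[of "c 0" "c 1" "L 0" "L 1"])
         (use inj L[of 0] L[of 1] card cov in \<open>auto simp: two\<close>)
  qed
  have finAB: "finite A" "finite B"
    using cover pair_finite_verts by (metis finite_Un)+
  have cardAB: "card A < n div 2" "card B < n div 2"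
    using cAB n assms(3) by auto
  obtain c L where c: "inj_on c {..<k}" "\<And>i. i < k \<Longrightarrow> L i \<subseteq> parcs G `` {c i}"
    "\<And>i. i < k \<Longrightarrow> card (L i) = n div k - 1" "disjoint_family_on L {..<k}"
    by (rule contains_caterpillarE[OF Ck assms(2) n pair_finite_verts G(2)]) blast
  note centre = universal_not_double_star_centre[OF G(3) assms(1,2,4) univ c]
  \<comment> \<open>If \<open>u = a\<close>, the lemma applies with \<open>b\<close> as the other
    centre; for \<open>u = b\<close> the two leaf sets swap roles.\<close>
  have "u \<noteq> a"
    using centre[of b A B] ab cover finAB cardAB by blast
  moreover have "u \<noteq> b"
    using centre[of a B A] ab cover finAB cardAB by blast
  \<comment> \<open>More than three spine vertices leave one outside
    \<open>{u, a, b}\<close>.\<close>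
  moreover obtain i where i: "i < k" "c i \<notin> {u, a, b}"
  proof -
    have "card {u, a, b} < card (c ` {..<k})"
      using c(1) assms(1) by (simp add: card_image card_insert_if)
    then have "\<not> c ` {..<k} \<subseteq> {u, a, b}"
      using card_mono[of "{u, a, b}"] by (meson finite.intros leD)
    then show thesis
      using that by blast
  qed
  moreover define N where "N x = parcs G `` {c i} \<inter> parcs G `` {x} \<inter> parcs G `` {u}" for x
  ultimately have N: "card (N a) \<le> 2" "card (N b) \<le> 2"
    using card_common_neighbours_le_2[OF G(3), of "c i" a u]
      card_common_neighbours_le_2[OF G(3), of "c i" b u] by auto
  have finN: "finite (N x)" for x
    using finite_neighbours by (simp add: N_def)
  have "L i \<subseteq> pverts G"
    using c(2)[OF i(1)] arc_snd_in_verts by force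
  \<comment> \<open>Any further leaf of \<open>c i\<close> is adjacent to \<open>u\<close> and to
    one of \<open>a\<close>, \<open>b\<close>. Hence \<open>n div k - 1\<close> is at most 3 + 2 +
    2, while \<open>n \<ge> 6 * k\<^sup>2\<close> and \<open>k2\<close> give
    \<open>n \<ge> 30 * k\<close>.\<close>
  then have "L i \<subseteq> {u, a, b} \<union> (N a \<union> N b)"
    using c(2)[OF i(1)] univ ab cover by (fastforce simp: N_def)
  then have "card (L i) \<le> card ({u, a, b} \<union> (N a \<union> N b))"
    using finN by (intro card_mono) auto
  also have "\<dots> \<le> card {u, a, b} + (card (N a) + card (N b))"
    by (meson add_left_mono card_Un_le le_trans)
  also have "\<dots> \<le> 3 + (2 + 2)"
    using N by (intro add_mono) (auto simp: card_insert_if)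
  finally have "n div k \<le> 8"
    using c(3)[OF i(1)] by simp
  then have "n \<le> 8 * k"
    using assms(2) by (metis dvd_div_mult_self mult_le_mono1)
  then show False
    using assms(1,4) k2 by linarith
qed

end
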